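(* Let $k\geq 1$ be an integer. For any integers $\delta$ and $\Delta$ such that $\Delta\geq \delta\geq k+1$, there exists an infinite family $\mathcal{F}$ of (pairwise non-isomorphic) graphs with minimum degree $\delta$ and maximum degree $\Delta$, such that for every graph $G\in \mathcal{F}$, $$\gamma_{kS}(G) = |V(G)|\cdot\frac{\delta-\Delta+2k+I_{\delta}+I_{\Delta}}{\delta+\Delta+2+I_{\delta}-I_{\Delta}}\;.$$
   Context: All graphs are finite, simple and undirected, with nonempty vertex set. For each integer $n$, $I_n=1$ if $n\equiv k\pmod 2$, and $I_n=0$ otherwise. For a vertex $v$ of $G$, $N_G[v]$ denotes the closed neighborhood of $v$ (the set consisting of $v$ and all vertices adjacent to $v$). For $G$ of minimum degree at least $k-1$, a function $f:V(G)\rightarrow\{-1,1\}$ is a signed $k$-dominating function of $G$ if $\sum_{u\in N_G[v]}f(u)\geq k$ for all $v\in V(G)$. The signed $k$-domination number $\gamma_{kS}(G)$ is the minimum of $\sum_{v\in V(G)}f(v)$ over all signed $k$-dominating functions $f$ of $G$. *)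

theory Defs
  imports Complex_Main "Graph_Theory.Graph_Theory" "HOL-Number_Theory.Cong"
begin

text \<open>
  A finite simple undirected graph is a \<^locale>\<open>pair_graph\<close>: a finite, loop-free digraph whose
  arc relation is symmetric, an edge $uv$ being the pair of arcs $(u,v)$, $(v,u)$. The degree of a
  vertex is therefore its out-degree, and \<^const>\<open>digraph_iso\<close> is isomorphism of simple graphs.
\<close>

definition min_degree :: "'a pair_pre_digraph \<Rightarrow> nat" where
  "min_degree G = Min (out_degree (with_proj G) ` pverts G)"

definition max_degree :: "'a pair_pre_digraph \<Rightarrow> nat" where
  "max_degree G = Max (out_degree (with_proj G) ` pverts G)"

definition closed_nbhd :: "'a pair_pre_digraph \<Rightarrow> 'a \<Rightarrow> 'a set" where
  "closed_nbhd G v = insert v {u. (v, u) \<in> parcs G}"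

text \<open>
  Minimum degree at least $k-1$ need not be required below: it is forced by the existence of such
  an \<open>f\<close>, and conversely makes the constant function $1$ an example.
\<close>

definition signed_k_dominating :: "nat \<Rightarrow> 'a pair_pre_digraph \<Rightarrow> ('a \<Rightarrow> int) \<Rightarrow> bool" where
  "signed_k_dominating k G f \<longleftrightarrow>
     f \<in> pverts G \<rightarrow> {-1, 1} \<and> (\<forall>v\<in>pverts G. (\<Sum>u\<in>closed_nbhd G v. f u) \<ge> int k)"

text \<open>
  For a finite graph of minimum degree at least $k-1$ the set of weights is finite and nonempty
  (only the values of \<open>f\<close> on the vertices matter), so \<^const>\<open>Min\<close> is its actual minimum.
\<close>

definition signed_k_dom_number :: "nat \<Rightarrow> 'a pair_pre_digraph \<Rightarrow> int" where
  "signed_k_dom_number k G =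
     Min {(\<Sum>v\<in>pverts G. f v) | f. signed_k_dominating k G f}"

definition parity_ind :: "nat \<Rightarrow> nat \<Rightarrow> real" where
  "parity_ind k n = (if [n = k] (mod 2) then 1 else 0)"

end

theory Submission
  imports Defs
begin

text \<open>
  Let \<open>f\<close> be a signed \<open>k\<close>-dominating function whose closed neighbourhood sums are at most \<open>k + 1\<close>,
  and which is \<open>-1\<close> on vertices of minimum degree only. By parity, \<open>f\<close> minimises every single
  neighbourhood sum, and by double counting $\sum_v |N[v]| g(v) \ge \sum_v |N[v]| f(v)$ for every
  competitor \<open>g\<close>; since \<open>f\<close> is already maximal wherever the weight $|N[v]|$ exceeds its minimum,
  it is optimal. Such an \<open>f\<close> exists on a graph with two kinds of vertices, each positive one
  having \<open>a\<close> positive and \<open>b\<close> negative neighbours and each negative one having \<open>c\<close> positive and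
  \<open>d\<close> negative neighbours. To build one, take \<open>c\<close> copies of an \<open>a\<close>-regular and \<open>b\<close> copies of a
  \<open>d\<close>-regular graph on a common vertex set and join the copies of the same vertex that have
  different signs; the regular graphs are Cayley graphs of $(Z/2)^N$.
\<close>

section \<open>Optimal signed dominating functions\<close>

text \<open>Every summand is odd, so the parity of the sum is that of the number of
  summands.\<close>

lemma sum_sign_parity:
  fixes f :: "'a \<Rightarrow> int"
  assumes "finite A" "f \<in> A \<rightarrow> {-1, 1}"
  shows "even (sum f A) \<longleftrightarrow> even (card A)"
  using assms by (induction A rule: finite_induct) auto

lemma (in pair_graph) finite_closed_nbhd: "finite (closed_nbhd G v)"
proof -
  have "{u. (v, u) \<in> parcs G} \<subseteq> pverts G"
    by (auto dest: in_arcsD2)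
  then show ?thesis
    using pair_finite_verts by (auto simp: closed_nbhd_def intro: finite_subset)
qed

lemma (in pair_graph) closed_nbhd_subset: "v \<in> pverts G \<Longrightarrow> closed_nbhd G v \<subseteq> pverts G"
  by (auto simp: closed_nbhd_def dest: in_arcsD2)

lemma (in pair_graph) closed_nbhd_sym: "u \<in> closed_nbhd G v \<longleftrightarrow> v \<in> closed_nbhd G u"
  using pair_sym_arcs by (auto simp: closed_nbhd_def symmetric_def dest: symD)

text \<open>Double counting: since closed neighbourhoods are symmetric, \<open>f u\<close> occurs
  once for every \<open>v\<close> in the closed neighbourhood of \<open>u\<close>.\<close>

lemma (in pair_graph) sum_closed_nbhd:
  fixes f :: "'a \<Rightarrow> int"
  shows "(\<Sum>v\<in>pverts G. \<Sum>u\<in>closed_nbhd G v. f u) =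
    (\<Sum>v\<in>pverts G. int (card (closed_nbhd G v)) * f v)"
proof -
  have "(\<Sum>v\<in>pverts G. \<Sum>u\<in>closed_nbhd G v. f u) =
      (\<Sum>v\<in>pverts G. \<Sum>u | u \<in> pverts G \<and> u \<in> closed_nbhd G v. f u)"
    by (intro sum.cong refl) (use closed_nbhd_subset in blast)
  also have "\<dots> = (\<Sum>u\<in>pverts G. \<Sum>v | v \<in> pverts G \<and> u \<in> closed_nbhd G v. f u)"
    by (rule sum.swap_restrict) (auto simp: pair_finite_verts)
  also have "\<dots> = (\<Sum>u\<in>pverts G. \<Sum>v\<in>closed_nbhd G u. f u)"
  proof (rule sum.cong[OF refl])
    fix u assume "u \<in> pverts G"
    then have "{v. v \<in> pverts G \<and> u \<in> closed_nbhd G v} = closed_nbhd G u"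
      using closed_nbhd_subset[of u] closed_nbhd_sym by blast
    then show "(\<Sum>v | v \<in> pverts G \<and> u \<in> closed_nbhd G v. f u) = (\<Sum>v\<in>closed_nbhd G u. f u)"
      by simp
  qed
  finally show ?thesis by simp
qed

lemma (in pair_graph) signed_k_dom_number_eqI:
  assumes f: "signed_k_dominating k G f"
    and tight: "\<And>v. v \<in> pverts G \<Longrightarrow> (\<Sum>u\<in>closed_nbhd G v. f u) \<le> int k + 1"
    and deg_ge: "\<And>v. v \<in> pverts G \<Longrightarrow> card (closed_nbhd G v) \<ge> s"
    and deg_neg: "\<And>v. v \<in> pverts G \<Longrightarrow> f v = -1 \<Longrightarrow> card (closed_nbhd G v) = s"
    and "s > 0"
  shows "signed_k_dom_number k G = (\<Sum>v\<in>pverts G. f v)"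
proof -
  let ?V = "pverts G" and ?N = "closed_nbhd G"
  have fV: "f \<in> ?V \<rightarrow> {-1, 1}"
    using f by (simp add: signed_k_dominating_def)
  have lower: "sum f ?V \<le> sum g ?V" if g: "signed_k_dominating k G g" for g
  proof -
    have gV: "g \<in> ?V \<rightarrow> {-1, 1}"
      using g by (simp add: signed_k_dominating_def)
    have "sum f (?N v) \<le> sum g (?N v)" if v: "v \<in> ?V" for v
    proof -
      \<comment> \<open>The sum for \<open>f\<close> is \<open>k\<close> or \<open>k + 1\<close>,
        hence the least integer of its parity that is at least \<open>k\<close>.\<close>
      have "even (sum f (?N v)) \<longleftrightarrow> even (sum g (?N v))"
        using closed_nbhd_subset[OF v] fV gV finite_closed_nbhd
        by (subst (1 2) sum_sign_parity) auto
      moreover have "int k \<le> sum g (?N v)" "int k \<le> sum f (?N v)"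
        using f g v by (auto simp: signed_k_dominating_def)
      ultimately show ?thesis
        using tight[OF v] by presburger
    qed
    then have "(\<Sum>v\<in>?V. sum f (?N v)) \<le> (\<Sum>v\<in>?V. sum g (?N v))"
      by (rule sum_mono)
    then have "(\<Sum>v\<in>?V. int (card (?N v)) * f v) \<le> (\<Sum>v\<in>?V. int (card (?N v)) * g v)"
      by (simp only: sum_closed_nbhd)
    \<comment> \<open>The factor vanishes where \<open>f v = -1\<close>; elsewhere it is nonnegative
      and \<open>f v = 1\<close> is the largest possible value.\<close>
    moreover have "(\<Sum>v\<in>?V. (int (card (?N v)) - int s) * g v) \<le>
        (\<Sum>v\<in>?V. (int (card (?N v)) - int s) * f v)"
    proof (rule sum_mono)
      fix v assume v: "v \<in> ?V"
      show "(int (card (?N v)) - int s) * g v \<le> (int (card (?N v)) - int s) * f v"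
      proof (cases "f v = -1")
        case True
        then show ?thesis using deg_neg v by simp
      next
        case False
        moreover have "f v \<in> {-1, 1}" "g v \<in> {-1, 1}"
          using fV gV v by blast+
        ultimately have "g v \<le> f v" by auto
        then show ?thesis using deg_ge[OF v] by (intro mult_left_mono) auto
      qed
    qed
    \<comment> \<open>Adding the two inequalities cancels the terms weighted by neighbourhood size
      and leaves the constant weight \<open>s\<close>.\<close>
    ultimately have "int s * sum f ?V \<le> int s * sum g ?V"
      by (simp add: left_diff_distrib sum_subtractf sum_distrib_left)
    then show ?thesis using \<open>s > 0\<close> by simp
  qed
  let ?W = "{sum g ?V | g. signed_k_dominating k G g}"
  \<comment> \<open>\<open>Min\<close> needs a finite set: the weights are integers bounded in
    absolute value by the order of the graph.\<close>
  have "?W \<subseteq> {- int (card ?V)..int (card ?V)}"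
  proof clarsimp
    fix g assume "signed_k_dominating k G g"
    then have g: "g v \<ge> -1 \<and> g v \<le> 1" if "v \<in> ?V" for v
      using that by (force simp: signed_k_dominating_def Pi_iff)
    show "- int (card ?V) \<le> sum g ?V \<and> sum g ?V \<le> int (card ?V)"
      using sum_bounded_below[of ?V "-1" g] sum_bounded_above[of ?V g 1] g by auto
  qed
  then have "finite ?W" by (rule finite_subset) simp
  then show ?thesis
    unfolding signed_k_dom_number_def using f lower by (intro Min_eqI) auto
qed

lemma out_degree_with_proj: "out_degree (with_proj G) v = card {u. (v, u) \<in> parcs G}"
proof -
  have "out_arcs (with_proj G) v = Pair v ` {u. (v, u) \<in> parcs G}"
    by (auto simp: out_arcs_def)
  then show ?thesis
    by (simp add: out_degree_def card_image inj_on_def)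
qed

text \<open>The invariant that will tell the members of the family apart.\<close>

lemma digraph_iso_card_verts:
  assumes "digraph_iso G H"
  shows "card (verts G) = card (verts H)"
  using assms by (auto simp: digraph_iso_def verts_app_iso card_image
      pre_digraph.digraph_isomorphism_inj_on_verts)

section \<open>The extremal graphs\<close>

type_synonym vertex = "(nat + nat) \<times> nat"

text \<open>\<open>Inl i\<close> labels a positive copy and \<open>Inr j\<close> a negative one. A
  vertex meets all copies of the opposite sign at its own position, so \<open>c\<close> positive
  copies give each negative vertex \<open>c\<close> positive neighbours.\<close>

definition ext_verts :: "nat \<Rightarrow> nat \<Rightarrow> nat \<Rightarrow> vertex set" where
  "ext_verts b c N = ({..<c} <+> {..<b}) \<times> {..<2 ^ N}"

text \<open>
  The numbers below $2^N$ stand for the elements of $(Z/2)^N$, and flipping a bit adds a generator.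
\<close>

fun ext_nbhd :: "nat \<Rightarrow> nat \<Rightarrow> nat \<Rightarrow> nat \<Rightarrow> vertex \<Rightarrow> vertex set" where
  "ext_nbhd a b c d (Inl i, x) =
     (\<lambda>l. (Inl i, flip_bit l x)) ` {..<a} \<union> (\<lambda>j. (Inr j, x)) ` {..<b}"
| "ext_nbhd a b c d (Inr j, x) =
     (\<lambda>l. (Inr j, flip_bit l x)) ` {..<d} \<union> (\<lambda>i. (Inl i, x)) ` {..<c}"

text \<open>Encoding by \<open>to_nat\<close> gives the vertices the type \<open>nat\<close> that
  the theorem asks for.\<close>

definition ext_graph :: "nat \<Rightarrow> nat \<Rightarrow> nat \<Rightarrow> nat \<Rightarrow> nat \<Rightarrow> nat pair_pre_digraph" where
  "ext_graph a b c d N =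
     \<lparr>pverts = to_nat ` ext_verts b c N,
      parcs = {(to_nat u, to_nat v) | u v. u \<in> ext_verts b c N \<and> v \<in> ext_nbhd a b c d u}\<rparr>"

definition ext_sign :: "nat \<Rightarrow> int" where
  "ext_sign n = (case from_nat n :: vertex of (Inl i, x) \<Rightarrow> 1 | (Inr j, x) \<Rightarrow> -1)"

section \<open>Bit flips as translations by generators\<close>

lemma flip_bit_less:
  fixes x :: nat
  assumes "x < 2 ^ N" "l < N"
  shows "flip_bit l x < 2 ^ N"
proof -
  \<comment> \<open>As \<open>l < N\<close>, the flip commutes with truncation to the low
    \<open>N\<close> bits, and truncation fixes \<open>x\<close>.\<close>
  have "take_bit N (flip_bit l x) = flip_bit l (take_bit N x)"
    using assms by (simp add: take_bit_flip_bit_eq)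
  then show ?thesis
    using assms by (metis take_bit_nat_eq_self take_bit_nat_less_exp)
qed

lemma flip_bit_flip_bit: "flip_bit l (flip_bit l x) = (x :: nat)"
  by (rule bit_eqI) (auto simp: bit_simps)

lemma flip_bit_neq: "flip_bit l x \<noteq> (x :: nat)"
proof
  assume "flip_bit l x = x"
  then have "bit (flip_bit l x) l = bit x l" by simp
  then show False by (simp add: bit_simps)
qed

lemma flip_bit_inj: "flip_bit l x = flip_bit m (x :: nat) \<longleftrightarrow> l = m"
proof
  assume "flip_bit l x = flip_bit m x"
  then have "bit (flip_bit l x) l = bit (flip_bit m x) l" by simp
  then show "l = m" by (auto simp: bit_simps)
qed simp

section \<open>Adjacency and degrees\<close>

lemma finite_ext_verts: "finite (ext_verts b c N)"
  by (simp add: ext_verts_def)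

lemma card_ext_verts: "card (ext_verts b c N) = (c + b) * 2 ^ N"
  by (simp add: ext_verts_def card_cartesian_product card_Plus)

lemma ext_nbhd_subset:
  assumes "a \<le> N" "d \<le> N" "u \<in> ext_verts b c N"
  shows "ext_nbhd a b c d u \<subseteq> ext_verts b c N"
  using assms
  by (cases "(a, b, c, d, u)" rule: ext_nbhd.cases) (auto simp: ext_verts_def flip_bit_less)

text \<open>Inside a copy each flip is an involution; between copies, vertices of opposite sign at
  the same position are all joined.\<close>

lemma ext_nbhd_sym:
  assumes "u \<in> ext_verts b c N" "v \<in> ext_nbhd a b c d u"
  shows "u \<in> ext_nbhd a b c d v"
  using assms by (cases "(a, b, c, d, u)" rule: ext_nbhd.cases)
    (auto simp: ext_verts_def image_iff intro!: bexI flip_bit_flip_bit[symmetric])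

lemma ext_nbhd_irrefl: "u \<notin> ext_nbhd a b c d u"
  by (cases "(a, b, c, d, u)" rule: ext_nbhd.cases) (auto dest: sym simp: flip_bit_neq)

lemma finite_ext_nbhd: "finite (ext_nbhd a b c d u)"
  by (cases "(a, b, c, d, u)" rule: ext_nbhd.cases) auto

lemma inj_on_flip:
  "inj_on (\<lambda>l. (p, flip_bit l (x :: nat))) A"
  by (auto simp: inj_on_def flip_bit_inj)

lemma card_ext_nbhd:
  "card (ext_nbhd a b c d (Inl i, x)) = a + b"
  "card (ext_nbhd a b c d (Inr j, x)) = d + c"
  unfolding ext_nbhd.simps
  by (subst card_Un_disjoint; auto simp: card_image inj_on_flip inj_on_def)+

lemma pair_graph_ext_graph:
  assumes "a \<le> N" "d \<le> N"
  shows "pair_graph (ext_graph a b c d N)"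
proof -
  let ?G = "ext_graph a b c d N"
  have sub: "parcs ?G \<subseteq> pverts ?G \<times> pverts ?G"
    using ext_nbhd_subset[OF assms] by (fastforce simp: ext_graph_def)
  have fin: "finite (pverts ?G)"
    by (simp add: ext_graph_def finite_ext_verts)
  show ?thesis
  proof
    show "finite (parcs ?G)"
      using sub fin by (meson finite_SigmaI finite_subset)
    show "symmetric (with_proj ?G)"
      using ext_nbhd_subset[OF assms] ext_nbhd_sym
      by (fastforce simp: symmetric_def ext_graph_def intro!: symI)
    show "fst e \<noteq> snd e" if "e \<in> parcs ?G" for e
      using that ext_nbhd_irrefl by (fastforce simp: ext_graph_def)
  qed (use sub fin in auto)
qed

lemma ext_graph_nbhd:
  assumes "u \<in> ext_verts b c N"
  shows "{w. (to_nat u, w) \<in> parcs (ext_graph a b c d N)} = to_nat ` ext_nbhd a b c d u"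
  using assms by (auto simp: ext_graph_def simp del: split_paired_Ex)

lemma out_degree_ext_graph:
  assumes "u \<in> ext_verts b c N"
  shows "out_degree (with_proj (ext_graph a b c d N)) (to_nat u) = card (ext_nbhd a b c d u)"
  using assms by (simp add: out_degree_with_proj ext_graph_nbhd card_image)

lemma closed_nbhd_ext_graph:
  assumes "u \<in> ext_verts b c N"
  shows "closed_nbhd (ext_graph a b c d N) (to_nat u) = to_nat ` insert u (ext_nbhd a b c d u)"
  using assms by (simp add: closed_nbhd_def ext_graph_nbhd)

lemma card_closed_nbhd_ext_graph:
  assumes "u \<in> ext_verts b c N"
  shows "card (closed_nbhd (ext_graph a b c d N) (to_nat u)) = Suc (card (ext_nbhd a b c d u))"
  unfolding closed_nbhd_ext_graph[OF assms]
  by (subst card_image) (simp_all add: inj_on_def ext_nbhd_irrefl finite_ext_nbhd)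

section \<open>Signs and the signed domination number\<close>

lemma ext_sign_simps [simp]:
  "ext_sign (to_nat ((Inl i, x) :: vertex)) = 1"
  "ext_sign (to_nat ((Inr j, x) :: vertex)) = -1"
  by (simp_all add: ext_sign_def)

lemma sum_ext_sign_closed_nbhd:
  assumes "u \<in> ext_verts b c N"
  shows "(\<Sum>w\<in>closed_nbhd (ext_graph a b c d N) (to_nat u). ext_sign w) =
    (case u of (Inl i, x) \<Rightarrow> 1 + int a - int b | (Inr j, x) \<Rightarrow> int c - int d - 1)"
proof -
  have "(\<Sum>w\<in>closed_nbhd (ext_graph a b c d N) (to_nat u). ext_sign w) =
      ext_sign (to_nat u) + (\<Sum>w\<in>ext_nbhd a b c d u. ext_sign (to_nat w))"
    unfolding closed_nbhd_ext_graph[OF assms]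
    by (subst sum.reindex) (simp_all add: inj_on_def ext_nbhd_irrefl finite_ext_nbhd)
  also have "\<dots> = (case u of (Inl i, x) \<Rightarrow> 1 + int a - int b | (Inr j, x) \<Rightarrow> int c - int d - 1)"
    by (cases "(a, b, c, d, u)" rule: ext_nbhd.cases; clarsimp; subst sum.union_disjoint;
        auto simp: sum.reindex inj_on_flip inj_on_def)
  finally show ?thesis .
qed

lemma sum_ext_sign: "(\<Sum>v\<in>pverts (ext_graph a b c d N). ext_sign v) = (int c - int b) * 2 ^ N"
proof -
  have "(\<Sum>v\<in>pverts (ext_graph a b c d N). ext_sign v) =
      (\<Sum>u\<in>ext_verts b c N. ext_sign (to_nat u))"
    by (simp add: ext_graph_def sum.reindex)
  also have "\<dots> = (\<Sum>p\<in>{..<c} <+> {..<b}. \<Sum>x\<in>{..<2 ^ N}. ext_sign (to_nat ((p, x) :: vertex)))"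
    by (simp add: ext_verts_def sum.cartesian_product)
  also have "\<dots> = (int c - int b) * 2 ^ N"
    by (simp add: sum.Plus algebra_simps)
  finally show ?thesis .
qed

text \<open>The last two hypotheses put every neighbourhood sum at \<open>k\<close> or
  \<open>k + 1\<close>; \<open>c + d \<le> a + b\<close> gives the negative vertices minimum
  degree.\<close>

lemma signed_k_dom_number_ext_graph:
  assumes "a \<le> N" "d \<le> N" "c + d \<le> a + b"
    and "1 + int a - int b \<in> {int k, int k + 1}" "int c - int d - 1 \<in> {int k, int k + 1}"
  shows "signed_k_dom_number k (ext_graph a b c d N) = (int c - int b) * 2 ^ N"
proof -
  interpret pair_graph "ext_graph a b c d N"
    using assms pair_graph_ext_graph by blast
  let ?G = "ext_graph a b c d N"
  have verts: "\<exists>u\<in>ext_verts b c N. v = to_nat u" if "v \<in> pverts ?G" for v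
    using that by (auto simp: ext_graph_def)
  have "signed_k_dom_number k ?G = (\<Sum>v\<in>pverts ?G. ext_sign v)"
  proof (rule signed_k_dom_number_eqI[where s = "Suc (c + d)"])
    have "int k \<le> (\<Sum>u\<in>closed_nbhd ?G v. ext_sign u) \<and>
        (\<Sum>u\<in>closed_nbhd ?G v. ext_sign u) \<le> int k + 1" if "v \<in> pverts ?G" for v
      using verts[OF that] assms(4,5)
      by (auto simp: sum_ext_sign_closed_nbhd split: sum.split)
    moreover have "ext_sign v \<in> {-1, 1}" for v
      by (auto simp: ext_sign_def split: prod.split sum.split)
    ultimately show "signed_k_dominating k ?G ext_sign"
      "\<And>v. v \<in> pverts ?G \<Longrightarrow> (\<Sum>u\<in>closed_nbhd ?G v. ext_sign u) \<le> int k + 1"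
      by (auto simp: signed_k_dominating_def)
  next
    fix v assume "v \<in> pverts ?G"
    then obtain p x where v: "(p, x) \<in> ext_verts b c N" "v = to_nat (p, x)"
      using verts by force
    show "Suc (c + d) \<le> card (closed_nbhd ?G v)"
      using v assms(3) by (cases p) (auto simp: card_closed_nbhd_ext_graph card_ext_nbhd simp del: ext_nbhd.simps)
    show "card (closed_nbhd ?G v) = Suc (c + d)" if "ext_sign v = -1"
      using v that by (cases p) (auto simp: card_closed_nbhd_ext_graph card_ext_nbhd simp del: ext_nbhd.simps)
  qed simp
  then show ?thesis by (simp only: sum_ext_sign)
qed

text \<open>Positivity of \<open>b\<close> and \<open>c\<close> ensures that vertices of both signs
  exist, so that both degrees are attained.\<close>

lemma out_degrees_ext_graph:
  assumes "b > 0" "c > 0"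
  shows "out_degree (with_proj (ext_graph a b c d N)) ` pverts (ext_graph a b c d N) =
    {a + b, c + d}"
proof -
  have "out_degree (with_proj (ext_graph a b c d N)) ` pverts (ext_graph a b c d N) =
      (\<lambda>u. card (ext_nbhd a b c d u)) ` ext_verts b c N"
    by (simp add: ext_graph_def image_image flip: out_degree_ext_graph[unfolded ext_graph_def])
  also have "\<dots> = {a + b, c + d}"
  proof
    show "(\<lambda>u. card (ext_nbhd a b c d u)) ` ext_verts b c N \<subseteq> {a + b, c + d}"
      by (auto simp: ext_verts_def card_ext_nbhd simp del: ext_nbhd.simps)
    have "(Inl 0, 0) \<in> ext_verts b c N" "(Inr 0, 0) \<in> ext_verts b c N"
      using assms by (auto simp: ext_verts_def)
    from this[THEN imageI[where f = "\<lambda>u. card (ext_nbhd a b c d u)"]]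
    show "{a + b, c + d} \<subseteq> (\<lambda>u. card (ext_nbhd a b c d u)) ` ext_verts b c N"
      by (simp add: card_ext_nbhd add.commute[of d] del: ext_nbhd.simps)
  qed
  finally show ?thesis .
qed

lemma card_pverts_ext_graph: "card (pverts (ext_graph a b c d N)) = (c + b) * 2 ^ N"
  by (simp add: ext_graph_def card_image card_ext_verts)

section \<open>Choice of parameters and the infinite family\<close>

lemma cong_2_iff_even_add: "[m = n] (mod 2) \<longleftrightarrow> even (m + n)" for m n :: nat
  unfolding cong_def by presburger

theorem theorem5:
  fixes k \<delta> \<Delta> :: nat
  assumes "k \<ge> 1" and "\<Delta> \<ge> \<delta>" and "\<delta> \<ge> k + 1"
  shows "\<exists>\<F> :: nat pair_pre_digraph set.
    infinite \<F> \<and>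
    (\<forall>G\<in>\<F>. \<forall>H\<in>\<F>. G \<noteq> H \<longrightarrow> \<not> digraph_iso (with_proj G) (with_proj H)) \<and>
    (\<forall>G\<in>\<F>. pair_graph G \<and> pverts G \<noteq> {} \<and>
       min_degree G = \<delta> \<and> max_degree G = \<Delta> \<and>
       real_of_int (signed_k_dom_number k G) =
         real (card (pverts G)) *
           ((real \<delta> - real \<Delta> + 2 * real k + parity_ind k \<delta> + parity_ind k \<Delta>) /
            (real \<delta> + real \<Delta> + 2 + parity_ind k \<delta> - parity_ind k \<Delta>)))"
proof -
  \<comment> \<open>With \<open>a + b = \<Delta>\<close>, this is the largest \<open>b\<close> for
    which \<open>1 + a - b \<ge> k\<close>.\<close>
  define b where "b = (\<Delta> + 1 - k) div 2"
  define a where "a = \<Delta> - b"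
  \<comment> \<open>With \<open>c + d = \<delta>\<close>, this is the smallest \<open>c\<close> for
    which \<open>c - d - 1 \<ge> k\<close>; the 2 rounds the half of \<open>\<delta> + k + 1\<close>
    up.\<close>
  define c where "c = (\<delta> + k + 2) div 2"
  define d where "d = \<delta> - c"
  \<comment> \<open>From \<open>\<delta> \<ge> k + 1\<close> follow \<open>b \<ge> 1\<close> and
    \<open>c \<le> \<delta>\<close>, so the subtraction defining \<open>d\<close> is exact.\<close>
  have pos: "b > 0" "c > 0" and deg: "a + b = \<Delta>" "c + d = \<delta>"
    using assms unfolding a_def b_def c_def d_def by presburger+
  have real_b: "2 * real b = real \<Delta> + 1 - real k - parity_ind k \<Delta>"
    and a: "1 + int a - int b \<in> {int k, int k + 1}"
  proof -
    \<comment> \<open>The indicator is what rounding down loses: \<open>\<Delta> + 1 - k\<close> is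
      odd exactly when \<open>\<Delta>\<close> and \<open>k\<close> have the same parity.\<close>
    have "2 * b + k + (if [\<Delta> = k] (mod 2) then 1 else 0) = \<Delta> + 1"
      using assms unfolding b_def cong_2_iff_even_add
      by (cases "even (\<Delta> + k)") (auto simp: odd_two_times_div_two_nat)
    then show "2 * real b = real \<Delta> + 1 - real k - parity_ind k \<Delta>"
      "1 + int a - int b \<in> {int k, int k + 1}"
      using deg by (auto simp: parity_ind_def split: if_splits)
  qed
  have real_c: "2 * real c = real \<delta> + 1 + real k + parity_ind k \<delta>"
    and d: "int c - int d - 1 \<in> {int k, int k + 1}"
  proof -
    have "2 * c = \<delta> + 1 + k + (if [\<delta> = k] (mod 2) then 1 else 0)"
      using assms unfolding c_def cong_2_iff_even_add
      by (cases "even (\<delta> + k)") (auto simp: odd_two_times_div_two_nat)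
    then show "2 * real c = real \<delta> + 1 + real k + parity_ind k \<delta>"
      "int c - int d - 1 \<in> {int k, int k + 1}"
      using deg by (auto simp: parity_ind_def split: if_splits)
  qed
  have ratio: "(real \<delta> - real \<Delta> + 2 * real k + parity_ind k \<delta> + parity_ind k \<Delta>) /
      (real \<delta> + real \<Delta> + 2 + parity_ind k \<delta> - parity_ind k \<Delta>) =
      (real c - real b) / (real c + real b)"
  proof -
    have "real \<delta> - real \<Delta> + 2 * real k + parity_ind k \<delta> + parity_ind k \<Delta> = 2 * (real c - real b)"
      "real \<delta> + real \<Delta> + 2 + parity_ind k \<delta> - parity_ind k \<Delta> = 2 * (real c + real b)"
      using real_b real_c by simp_all
    then show ?thesis by (simp only: mult_divide_mult_cancel_left_if) simp
  qed
  let ?G = "ext_graph a b c d"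
  \<comment> \<open>Starting at \<open>a + d\<close> leaves enough bits for both regular graphs; the
    order \<open>(c + b) * 2 ^ N\<close> determines \<open>N\<close>.\<close>
  let ?F = "?G ` {a + d..}"
  have inj: "N = M" if "card (pverts (?G N)) = card (pverts (?G M))" for N M
    using that pos by (simp add: card_pverts_ext_graph)
  have "infinite ?F"
    using inj by (subst finite_image_iff) (auto simp: inj_on_def infinite_Ici)
  moreover have "\<not> digraph_iso (with_proj G) (with_proj H)" if "G \<in> ?F" "H \<in> ?F" "G \<noteq> H" for G H
  proof
    assume "digraph_iso (with_proj G) (with_proj H)"
    then have "card (pverts G) = card (pverts H)"
      using digraph_iso_card_verts by fastforce
    with that inj show False by blast
  qed
  moreover have "pair_graph G \<and> pverts G \<noteq> {} \<and> min_degree G = \<delta> \<and> max_degree G = \<Delta> \<and>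
      real_of_int (signed_k_dom_number k G) =
        real (card (pverts G)) * ((real c - real b) / (real c + real b))" if "G \<in> ?F" for G
  proof -
    obtain N where G: "G = ?G N" and N: "a \<le> N" "d \<le> N"
      using \<open>G \<in> ?F\<close> by auto
    have card: "card (pverts G) = (c + b) * 2 ^ N"
      by (simp add: G card_pverts_ext_graph)
    then have "pverts G \<noteq> {}"
      using pos by auto
    moreover have "min_degree G = \<delta>" "max_degree G = \<Delta>"
      using assms(2) pos
      by (simp_all add: G min_degree_def max_degree_def out_degrees_ext_graph deg)
    moreover have "signed_k_dom_number k G = (int c - int b) * 2 ^ N"
      unfolding G using N a d deg assms(2) by (intro signed_k_dom_number_ext_graph) auto
    moreover have "pair_graph G"
      unfolding G using N by (rule pair_graph_ext_graph)
    moreover have "real_of_int ((int c - int b) * 2 ^ N) =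
        real ((c + b) * 2 ^ N) * ((real c - real b) / (real c + real b))"
      using pos by (simp add: field_simps)
    ultimately show ?thesis
      by (simp only: card) simp
  qed
  ultimately show ?thesis
    unfolding ratio by (intro exI[of _ ?F]) blast
qed

end
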